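(* Let $\mathbf r=(\psi,\psi\cos\theta,\psi\sin\theta)$ be a space-periodic soliton on $LC^*$ of the flow $\frac{\partial\mathbf r}{\partial t}=(k_g)_s\mathbf r-k_g\mathbf T$, with integration constants $\lambda,\mu$, and suppose its rotation axis is space-like and has been aligned with the $z$-axis through a suitable rotation of $\mathbb E^3_1$. If the soliton rotates around the $z$-axis, then necessarily $\mu<0$ and $\psi$ is expressed as $$\psi\sin\theta=\frac{-k_g}{\sqrt{-\mu}} .$$
   Context: $\mathbb E^3_1$ is $\mathbb R^3$ with coordinates $(x,y,z)$ and $\langle \mathbf u,\mathbf v\rangle_L=-u_1v_1+u_2v_2+u_3v_3$; $LC^*=\{(\psi,\psi\cos\theta,\psi\sin\theta):\psi>0\}$. For a smooth curve $\mathbf r$ on $LC^*$ with space-like velocity, $s$ is arc length, $\mathbf T=\mathbf r_s$, $\mathbf Y$ is the unique light-like field along $\mathbf r$ with $\langle \mathbf Y,\mathbf T\rangle_L=0$, $\langle\mathbf r,\mathbf Y\rangle_L=1$, and $k_g=\langle\mathbf r_{ss},\mathbf Y\rangle_L$. Along the curve $d\theta/ds=1/\psi$. A soliton of the flow is a curve moving by isometries under it; equivalently $(k_g)_{sss}-3k_g(k_g)_s=0$, which integrates to $$(k_g)_{ss}-\tfrac32k_g^2+\tfrac\lambda2=0,\qquad ((k_g)_s)^2-k_g^3+\lambda k_g+\mu=0$$ with integration constants $\lambda,\mu$. A space-periodic soliton is one for which $k_g(s)$ is non-constant and periodic; then $\lambda>3(\mu/2)^{2/3}$, the cubic $x^3-\lambda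 x-\mu$ has three distinct real roots $x_1<x_2<x_3$, and $k_g$ oscillates between $x_1$ and $x_2$. Rotations around the $z$-axis are the maps $(x,y,z)\mapsto(x\cosh\omega+y\sinh\omega,\;x\sinh\omega+y\cosh\omega,\;z)$, with Killing field $y\partial_x+x\partial_y$, which on $LC^*$ equals $\psi\cos\theta\,\partial_\psi-\sin\theta\,\partial_\theta$. The soliton "rotates around the $z$-axis" if the isometries moving it are these rotations, i.e. along $\mathbf r$ the field $\mathbf J=(k_g)_s\mathbf r-k_g\mathbf T$ is a non-zero constant multiple of this Killing field.
   Formalization: With J equal to c times the Killing field, the displayed formula has the right sign only for c<0; for c>0 it fails for r (the sign is +) and is proved instead for r turned by π about the x-axis, as part of the suitable rotation. μ<0 is proved for both signs. *)

theory Defs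
  imports "HOL-Analysis.Analysis"
begin

definition lorentz :: "real^3 \<Rightarrow> real^3 \<Rightarrow> real" where
  "lorentz u v = - (u$1 * v$1) + u$2 * v$2 + u$3 * v$3"

definition lc_point :: "real \<Rightarrow> real \<Rightarrow> real^3" where
  "lc_point p a = vector [p, p * cos a, p * sin a]"

definition light_cone :: "(real^3) set" where
  "light_cone = {lc_point p a | p a. p > 0}"

definition curve_deriv :: "(real \<Rightarrow> real^3) \<Rightarrow> real \<Rightarrow> real^3" where
  "curve_deriv r s = vector_derivative r (at s)"

definition smooth_curve :: "(real \<Rightarrow> real^3) \<Rightarrow> bool" where
  "smooth_curve r \<longleftrightarrow> (\<forall>n s. ((curve_deriv ^^ n) r) differentiable (at s))"

text \<open>Curves are parametrized by arc length \<open>s\<close>, with \<open>s\<close> ranging over the whole line.\<close>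

definition lc_curve :: "(real \<Rightarrow> real^3) \<Rightarrow> bool" where
  "lc_curve r \<longleftrightarrow> smooth_curve r \<and> (\<forall>s. r s \<in> light_cone) \<and>
     (\<forall>s. lorentz (curve_deriv r s) (curve_deriv r s) = 1)"

text \<open>The derivative condition fixes the orientation; unit speed alone gives
  \<open>d\<theta>/ds = \<plusminus> 1/\<psi>\<close>.\<close>

definition lc_coordinates :: "(real \<Rightarrow> real^3) \<Rightarrow> (real \<Rightarrow> real) \<Rightarrow> (real \<Rightarrow> real) \<Rightarrow> bool" where
  "lc_coordinates r \<psi> \<theta> \<longleftrightarrow>
     (\<forall>s. \<psi> s > 0 \<and> r s = lc_point (\<psi> s) (\<theta> s) \<and>
          (\<theta> has_real_derivative 1 / \<psi> s) (at s))"

text \<open>The vector is nonzero, hence light-like, because its product with \<open>r s\<close> is 1. It is unique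
  whenever \<open>r\<close> is an \<^const>\<open>lc_curve\<close>.\<close>

definition lightlike_normal :: "(real \<Rightarrow> real^3) \<Rightarrow> real \<Rightarrow> real^3" where
  "lightlike_normal r s =
     (THE y. lorentz y y = 0 \<and> lorentz y (curve_deriv r s) = 0 \<and> lorentz (r s) y = 1)"

definition geod_curv :: "(real \<Rightarrow> real^3) \<Rightarrow> real \<Rightarrow> real" where
  "geod_curv r s = lorentz (curve_deriv (curve_deriv r) s) (lightlike_normal r s)"

definition flow_field :: "(real \<Rightarrow> real^3) \<Rightarrow> real \<Rightarrow> real^3" where
  "flow_field r s = deriv (geod_curv r) s *\<^sub>R r s - geod_curv r s *\<^sub>R curve_deriv r s"

text \<open>The flow preserves arc length, so \<open>s\<close> can serve as arc length at all times \<open>t\<close>.\<close>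

definition flow_solution :: "(real \<Rightarrow> real \<Rightarrow> real^3) \<Rightarrow> bool" where
  "flow_solution \<gamma> \<longleftrightarrow> (\<forall>t. lc_curve (\<gamma> t)) \<and>
     (\<forall>t s. ((\<lambda>\<tau>. \<gamma> \<tau> s) has_vector_derivative flow_field (\<gamma> t) s) (at t))"

definition lc_isometry :: "(real^3 \<Rightarrow> real^3) \<Rightarrow> bool" where
  "lc_isometry L \<longleftrightarrow> linear L \<and> (\<forall>u v. lorentz (L u) (L v) = lorentz u v) \<and>
     L ` light_cone = light_cone"

definition soliton :: "(real \<Rightarrow> real^3) \<Rightarrow> bool" where
  "soliton r \<longleftrightarrow> lc_curve r \<and>
     (\<exists>\<Phi>. (\<forall>t. lc_isometry (\<Phi> t)) \<and> \<Phi> 0 = id \<and> flow_solution (\<lambda>t s. \<Phi> t (r s)))"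

definition integration_constants :: "(real \<Rightarrow> real^3) \<Rightarrow> real \<Rightarrow> real \<Rightarrow> bool" where
  "integration_constants r lam \<mu> \<longleftrightarrow>
     (\<forall>s. deriv (deriv (geod_curv r)) s - 3 / 2 * (geod_curv r s)^2 + lam / 2 = 0) \<and>
     (\<forall>s. (deriv (geod_curv r) s)^2 - (geod_curv r s)^3 + lam * geod_curv r s + \<mu> = 0)"

definition space_periodic_soliton :: "(real \<Rightarrow> real^3) \<Rightarrow> real \<Rightarrow> real \<Rightarrow> bool" where
  "space_periodic_soliton r lam \<mu> \<longleftrightarrow> soliton r \<and> integration_constants r lam \<mu> \<and>
     \<not> (\<exists>k. \<forall>s. geod_curv r s = k) \<and>
     (\<exists>P>0. \<forall>s. geod_curv r (s + P) = geod_curv r s)"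

text \<open>Killing field of the rotations around the \<open>z\<close>-axis, that is, the derivative at \<open>\<omega> = 0\<close> of
  \<open>(x cosh \<omega> + y sinh \<omega>, x sinh \<omega> + y cosh \<omega>, z)\<close>.\<close>

definition killing_z :: "real^3 \<Rightarrow> real^3" where
  "killing_z v = vector [v$2, v$1, 0]"

definition rotates_around_z :: "(real \<Rightarrow> real^3) \<Rightarrow> real \<Rightarrow> bool" where
  "rotates_around_z r c \<longleftrightarrow> c \<noteq> 0 \<and> (\<forall>s. flow_field r s = c *\<^sub>R killing_z (r s))"

text \<open>Rotation by \<open>\<pi>\<close> about the \<open>x\<close>-axis (\<open>\<theta> \<mapsto> \<theta> + \<pi>\<close>). It maps the \<open>z\<close>-axis to itself with
  reversed direction and \<^const>\<open>killing_z\<close> to its negative.\<close>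

definition half_turn :: "real^3 \<Rightarrow> real^3" where
  "half_turn v = vector [v$1, - v$2, - v$3]"

end

theory Submission
  imports Defs
begin

text \<open>In the coordinates \<open>(\<psi>, \<theta>)\<close> the curvature is
  \<open>k = \<psi>''/\<psi> - (\<psi>'\<^sup>2 + 1)/(2\<psi>\<^sup>2)\<close>, and the component of the flow field along
  \<open>\<partial>\<^sub>\<theta>\<close> turns the rotation condition \<open>J = c X\<close> into \<open>k = c \<psi> sin \<theta>\<close>. Differentiating this
  twice gives \<open>2 k k'' - k'\<^sup>2 = 2 k\<^sup>3 - c\<^sup>2\<close>, which together with the two integrated soliton
  equations forces \<open>\<mu> = - c\<^sup>2\<close>. The sign of \<open>c\<close> is reversed by the half-turn about the
  \<open>x\<close>-axis, an isometry, under which all the notions involved are equivariant.\<close>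

subsection \<open>The Lorentz form and the light-like normal\<close>

lemma lorentz_commute: "lorentz u v = lorentz v u"
  by (simp add: lorentz_def)

lemma lorentz_bilinear [simp]:
  "lorentz (u + v) w = lorentz u w + lorentz v w"
  "lorentz w (u + v) = lorentz w u + lorentz w v"
  "lorentz (u - v) w = lorentz u w - lorentz v w"
  "lorentz w (u - v) = lorentz w u - lorentz w v"
  "lorentz (a *\<^sub>R u) w = a * lorentz u w"
  "lorentz w (a *\<^sub>R u) = a * lorentz w u"
  by (simp_all add: lorentz_def algebra_simps)

lemma lc_point_nth [simp]:
  "lc_point p a $ 1 = p" "lc_point p a $ 2 = p * cos a" "lc_point p a $ 3 = p * sin a"
  by (simp_all add: lc_point_def)

lemma half_turn_nth [simp]:
  "half_turn v $ 1 = v$1" "half_turn v $ 2 = - v$2" "half_turn v $ 3 = - v$3"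
  by (simp_all add: half_turn_def)

lemma killing_z_nth [simp]:
  "killing_z v $ 1 = v$2" "killing_z v $ 2 = v$1" "killing_z v $ 3 = 0"
  by (simp_all add: killing_z_def)

lemma lorentz_lc_point_self: "lorentz (lc_point p a) (lc_point p a) = 0"
proof -
  have "p * cos a * (p * cos a) + p * sin a * (p * sin a) = p * p * ((cos a)\<^sup>2 + (sin a)\<^sup>2)"
    by (simp only: power2_eq_square) algebra
  then show ?thesis by (simp add: lorentz_def)
qed

text \<open>The orthogonal complement of a light-like vector is a degenerate plane containing that
  vector, and modulo it the form is positive definite. A unit \<open>T\<close> spans the quotient,
  so only multiples of the point itself are orthogonal to both.\<close>

lemma lorentz_zero_of_orthogonal:
  assumes p: "p > 0" and T: "lorentz T T = 1" "lorentz (lc_point p a) T = 0"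
    and d: "lorentz d T = 0" "lorentz (lc_point p a) d = 0"
  shows "d = (d$1 / p) *\<^sub>R lc_point p a"
proof -
  define C S where "C = cos a" and "S = sin a"
  have CS: "C\<^sup>2 + S\<^sup>2 = 1" by (simp add: C_def S_def)
  have "p * (T$2 * C + T$3 * S - T$1) = 0"
    using T(2) by (simp add: lorentz_def C_def S_def algebra_simps)
  with p have T1: "T$1 = T$2 * C + T$3 * S" by simp
  have "p * (d$2 * C + d$3 * S - d$1) = 0"
    using d(2) by (simp add: lorentz_def C_def S_def algebra_simps)
  with p have d1: "d$1 = d$2 * C + d$3 * S" by simp
  \<comment> \<open>In the frame (C, S), (-S, C) of the second and third coordinates, the radial
    part cancels against the first coordinate; only the part along (-S, C) contributes to the
    form.\<close>
  have TT: "(T$3 * C - T$2 * S)\<^sup>2 = 1"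
    using T(1) T1 CS unfolding lorentz_def by algebra
  have "(d$3 * C - d$2 * S) * (T$3 * C - T$2 * S) = 0"
    using d(1) T1 d1 CS unfolding lorentz_def by algebra
  with TT have z: "d$3 * C - d$2 * S = 0" by auto
  have "d$2 = d$1 * C" "d$3 = d$1 * S" using z d1 CS by algebra+
  with p show ?thesis by (simp add: vec_eq_iff forall_3 C_def S_def)
qed

text \<open>Two candidates differ by a multiple \<alpha> of the point. Being light-like forces
  \<alpha> = 0, since <z + \<alpha> r, z + \<alpha> r> = 2 \<alpha> <r, z> = 2 \<alpha>.\<close>

lemma lightlike_normal_unique:
  assumes p: "p > 0" and T: "lorentz T T = 1" "lorentz (lc_point p a) T = 0"
    and y: "lorentz y y = 0" "lorentz y T = 0" "lorentz (lc_point p a) y = 1"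
    and z: "lorentz z z = 0" "lorentz z T = 0" "lorentz (lc_point p a) z = 1"
  shows "y = z"
proof -
  define \<alpha> where "\<alpha> = (y - z)$1 / p"
  have d: "y - z = \<alpha> *\<^sub>R lc_point p a"
    unfolding \<alpha>_def using lorentz_zero_of_orthogonal[OF p T, of "y - z"] y z by simp
  then have "y = z + \<alpha> *\<^sub>R lc_point p a" by (simp add: algebra_simps)
  then have "lorentz y y = 2 * \<alpha>"
    using z lorentz_lc_point_self[of p a] by (simp add: lorentz_commute[of z "lc_point p a"])
  with y d show ?thesis by simp
qed

text \<open>The first summand is light-like with product 1 with the point, but its product with
  \<open>T\<close> is \<open>q\<close>. Subtracting \<open>q T\<close> repairs this and makes the
  square -q^2; adding q^2/2 times the point restores it to 0 without disturbing the other two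
  products.\<close>

lemma lightlike_normal_exists:
  assumes p: "p > 0" and T: "lorentz T T = 1" "lorentz (lc_point p a) T = 0"
  defines "q \<equiv> T$1 / p"
  defines "y \<equiv> (1 / (2 * p)) *\<^sub>R vector [-1, cos a, sin a] - q *\<^sub>R T + (q\<^sup>2 / 2) *\<^sub>R lc_point p a"
  shows "lorentz y y = 0" "lorentz y T = 0" "lorentz (lc_point p a) y = 1"
proof -
  define N :: "real^3" where "N = (1 / (2 * p)) *\<^sub>R vector [-1, cos a, sin a]"
  have y: "y = N - q *\<^sub>R T + (q\<^sup>2 / 2) *\<^sub>R lc_point p a" by (simp add: y_def N_def)
  have cs: "cos a * cos a + sin a * sin a = 1"
    using sin_cos_squared_add[of a] by (simp add: power2_eq_square)
  have NN: "lorentz N N = 0"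
    using cs by (simp add: N_def) (simp add: lorentz_def algebra_simps)
  have "p * (cos a * cos a) + p * (sin a * sin a) = p"
    using cs by (simp flip: distrib_left)
  with p have rN: "lorentz (lc_point p a) N = 1"
    by (simp add: N_def) (simp add: lorentz_def field_simps)
  have "p * (T$2 * cos a + T$3 * sin a - T$1) = 0"
    using T(2) by (simp add: lorentz_def algebra_simps)
  with p have "T$1 = T$2 * cos a + T$3 * sin a" by simp
  then have NT: "lorentz N T = q"
    using p by (simp add: N_def q_def) (simp add: lorentz_def field_simps)
  show "lorentz y T = 0"
    by (simp add: y NT T)
  show "lorentz (lc_point p a) y = 1"
    by (simp add: y rN T lorentz_lc_point_self)
  show "lorentz y y = 0"
    by (simp add: y NN NT rN T lorentz_lc_point_self lorentz_commute[of T N]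
        lorentz_commute[of N "lc_point p a"] lorentz_commute[of T "lc_point p a"]
        algebra_simps power2_eq_square)
qed

subsection \<open>Curves on the light cone\<close>

lemma curve_deriv_eq: "(r has_vector_derivative D) (at s) \<Longrightarrow> curve_deriv r s = D"
  by (simp add: curve_deriv_def vector_derivative_at)

lemma smooth_curve_has_vector_derivative:
  assumes "smooth_curve r"
  shows "(((curve_deriv ^^ n) r) has_vector_derivative (curve_deriv ^^ Suc n) r s) (at s)"
proof -
  have "((curve_deriv ^^ n) r) differentiable (at s)"
    using assms unfolding smooth_curve_def by blast
  then show ?thesis by (simp add: curve_deriv_def vector_derivative_works)
qed

lemma has_vector_derivative_nth:
  assumes "(r has_vector_derivative D) (at s)"
  shows "((\<lambda>s. r s $ i) has_real_derivative D $ i) (at s)"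
  using bounded_linear.has_vector_derivative[OF bounded_linear_vec_nth assms]
  by (simp add: has_real_derivative_iff_has_vector_derivative)

lemma lc_curve_coordinates:
  assumes "lc_curve r"
  obtains p a where "p > 0" "r s = lc_point p a"
  using assms unfolding lc_curve_def light_cone_def by blast

lemma lc_curve_deriv:
  assumes "lc_curve r"
  shows "(r has_vector_derivative curve_deriv r s) (at s)"
    and "(curve_deriv r has_vector_derivative curve_deriv (curve_deriv r) s) (at s)"
  using assms smooth_curve_has_vector_derivative[of r 0 s]
    smooth_curve_has_vector_derivative[of r 1 s]
  by (simp_all add: lc_curve_def)

text \<open>This is the derivative of the identity <r, r> = 0.\<close>

lemma lc_curve_orthogonal:
  assumes "lc_curve r"
  shows "lorentz (r s) (curve_deriv r s) = 0"
proof -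
  note D = has_vector_derivative_nth[OF lc_curve_deriv(1)[OF assms, of s]]
  have "lorentz (r u) (r u) = 0" for u
    using lc_curve_coordinates[OF assms, of u] lorentz_lc_point_self by metis
  then have "((\<lambda>u. lorentz (r u) (r u)) has_real_derivative 0) (at s)" by simp
  moreover have "((\<lambda>u. lorentz (r u) (r u)) has_real_derivative
      2 * lorentz (r s) (curve_deriv r s)) (at s)"
    unfolding lorentz_def by (rule derivative_eq_intros D refl)+ (simp add: algebra_simps)
  ultimately have "2 * lorentz (r s) (curve_deriv r s) = 0" by (rule DERIV_unique[symmetric])
  then show ?thesis by simp
qed

text \<open>Resolves the definite description: the explicit formula and the equivariance of the
  normal then only require checking three equations.\<close>

lemma lightlike_normal_eqI:
  assumes r: "lc_curve r"
    and y: "lorentz y y = 0" "lorentz y (curve_deriv r s) = 0" "lorentz (r s) y = 1"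
  shows "lightlike_normal r s = y"
proof -
  obtain p a where pa: "p > 0" "r s = lc_point p a" using lc_curve_coordinates[OF r] .
  have T: "lorentz (curve_deriv r s) (curve_deriv r s) = 1" using r by (simp add: lc_curve_def)
  show ?thesis
    unfolding lightlike_normal_def
  proof (rule the_equality)
    fix z assume "lorentz z z = 0 \<and> lorentz z (curve_deriv r s) = 0 \<and> lorentz (r s) z = 1"
    then show "z = y"
      using lightlike_normal_unique[OF pa(1) T, of a z y] lc_curve_orthogonal[OF r, of s] y pa(2)
      by metis
  qed (use y in simp)
qed

lemma lightlike_normal_lc_point:
  assumes r: "lc_curve r" and pa: "p > 0" "r s = lc_point p a"
  shows "lightlike_normal r s = (1 / (2 * p)) *\<^sub>R vector [-1, cos a, sin a]
      - (curve_deriv r s $ 1 / p) *\<^sub>R curve_deriv r s + ((curve_deriv r s $ 1 / p)\<^sup>2 / 2) *\<^sub>R r s"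
proof -
  have "lorentz (curve_deriv r s) (curve_deriv r s) = 1" using r by (simp add: lc_curve_def)
  from lightlike_normal_exists[OF pa(1) this, of a] lc_curve_orthogonal[OF r, of s] pa(2)
  show ?thesis by (intro lightlike_normal_eqI[OF r]) simp_all
qed

lemma lightlike_normal_props:
  assumes r: "lc_curve r"
  shows "lorentz (lightlike_normal r s) (lightlike_normal r s) = 0"
    and "lorentz (lightlike_normal r s) (curve_deriv r s) = 0"
    and "lorentz (r s) (lightlike_normal r s) = 1"
proof -
  obtain p a where pa: "p > 0" "r s = lc_point p a" using lc_curve_coordinates[OF r] .
  have "lorentz (curve_deriv r s) (curve_deriv r s) = 1" using r by (simp add: lc_curve_def)
  note ex = lightlike_normal_exists[OF pa(1) this, of a]
  show "lorentz (lightlike_normal r s) (lightlike_normal r s) = 0"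
    and "lorentz (lightlike_normal r s) (curve_deriv r s) = 0"
    and "lorentz (r s) (lightlike_normal r s) = 1"
    using ex lc_curve_orthogonal[OF r, of s] pa(2)
    by (simp_all only: lightlike_normal_lc_point[OF r pa])
qed

subsection \<open>Equivariance under isometries\<close>

lemma curve_deriv_linear:
  assumes "linear L" "r differentiable (at s)"
  shows "curve_deriv (L \<circ> r) s = L (curve_deriv r s)"
  using bounded_linear.has_vector_derivative[of L r "curve_deriv r s" "at s"] assms
  by (intro curve_deriv_eq)
    (simp add: o_def linear_conv_bounded_linear curve_deriv_def vector_derivative_works)

text \<open>All orders are needed because \<open>smooth_curve\<close> speaks of every iterated
  derivative; orders 1 and 2 also serve the curvature.\<close>

lemma iterated_curve_deriv_linear:
  assumes "linear L" "smooth_curve r"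
  shows "(curve_deriv ^^ n) (L \<circ> r) = L \<circ> (curve_deriv ^^ n) r"
proof (induction n)
  case (Suc n)
  have "curve_deriv (L \<circ> (curve_deriv ^^ n) r) s = L (curve_deriv ((curve_deriv ^^ n) r) s)" for s
    using assms by (intro curve_deriv_linear) (auto simp: smooth_curve_def)
  then have "curve_deriv (L \<circ> (curve_deriv ^^ n) r) = L \<circ> curve_deriv ((curve_deriv ^^ n) r)"
    by (intro ext) (simp only: o_apply)
  then show ?case by (metis Suc.IH funpow.simps(2) o_apply)
qed simp

lemma smooth_curve_linear:
  assumes "linear L" "smooth_curve r"
  shows "smooth_curve (L \<circ> r)"
proof -
  have "(L \<circ> (curve_deriv ^^ n) r) differentiable (at s)" for n s
  proof (rule differentiable_chain_at)
    show "(curve_deriv ^^ n) r differentiable at s" using assms by (simp add: smooth_curve_def)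
    show "L differentiable at ((curve_deriv ^^ n) r s)"
      using assms(1) linear_imp_differentiable by blast
  qed
  then show ?thesis by (simp add: smooth_curve_def iterated_curve_deriv_linear[OF assms])
qed

context
  fixes L :: "real^3 \<Rightarrow> real^3" and r :: "real \<Rightarrow> real^3"
  assumes L: "lc_isometry L" and r: "lc_curve r"
begin

lemma curve_deriv_isometry:
  "curve_deriv (L \<circ> r) = L \<circ> curve_deriv r"
  "curve_deriv (L \<circ> curve_deriv r) = L \<circ> curve_deriv (curve_deriv r)"
  using iterated_curve_deriv_linear[of L r 1] iterated_curve_deriv_linear[of L r 2] L r
  by (simp_all add: lc_isometry_def lc_curve_def numeral_2_eq_2)

lemma lc_curve_isometry: "lc_curve (L \<circ> r)"
  using L r smooth_curve_linear[of L r] unfolding lc_curve_def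
  by (auto simp: lc_isometry_def curve_deriv_isometry)

text \<open>An isometry preserves the three equations that characterize the normal, so uniqueness
  does the rest.\<close>

lemma lightlike_normal_isometry: "lightlike_normal (L \<circ> r) s = L (lightlike_normal r s)"
  using lightlike_normal_props[OF r, of s] L
  by (intro lightlike_normal_eqI[OF lc_curve_isometry])
    (simp_all add: lc_isometry_def curve_deriv_isometry)

lemma geod_curv_isometry: "geod_curv (L \<circ> r) = geod_curv r"
  using L by (simp add: fun_eq_iff geod_curv_def curve_deriv_isometry lightlike_normal_isometry
      lc_isometry_def)

lemma flow_field_isometry: "flow_field (L \<circ> r) s = L (flow_field r s)"
proof -
  have "linear L" using L by (simp add: lc_isometry_def)
  then show ?thesis
    by (simp add: flow_field_def geod_curv_isometry curve_deriv_isometry linear_diff linear_scale)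
qed

end

text \<open>A fixed linear map commutes with the time derivative, and the flow field is
  equivariant.\<close>

lemma flow_solution_isometry:
  assumes "lc_isometry L" "flow_solution \<gamma>"
  shows "flow_solution (\<lambda>t. L \<circ> \<gamma> t)"
proof -
  have \<gamma>: "lc_curve (\<gamma> t)"
    "((\<lambda>\<tau>. \<gamma> \<tau> s) has_vector_derivative flow_field (\<gamma> t) s) (at t)" for t s
    using assms(2) by (auto simp: flow_solution_def)
  have "bounded_linear L"
    using assms(1) by (simp add: lc_isometry_def linear_conv_bounded_linear)
  from bounded_linear.has_vector_derivative[OF this \<gamma>(2)] show ?thesis
    using assms(1) \<gamma>(1)
    by (simp add: flow_solution_def lc_curve_isometry flow_field_isometry)
qed

lemma lc_isometry_comp:
  assumes "lc_isometry L" "lc_isometry M"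
  shows "lc_isometry (L \<circ> M)"
proof -
  have "(L \<circ> M) ` light_cone = L ` M ` light_cone" by (simp only: image_comp)
  with assms show ?thesis by (simp add: lc_isometry_def linear_compose)
qed

section \<open>The half-turn and its effect on rotating solitons\<close>

lemma half_turn_half_turn [simp]: "half_turn (half_turn v) = v"
  by (simp add: vec_eq_iff forall_3)

lemma half_turn_lc_point: "half_turn (lc_point p a) = lc_point p (a + pi)"
  by (simp add: vec_eq_iff forall_3)

lemma lc_isometry_half_turn: "lc_isometry half_turn"
proof -
  have "linear half_turn"
    by (rule linearI) (simp_all add: vec_eq_iff forall_3)
  moreover have "lorentz (half_turn u) (half_turn v) = lorentz u v" for u v
    by (simp add: lorentz_def)
  moreover have sub: "half_turn v \<in> light_cone" if "v \<in> light_cone" for v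
    using that half_turn_lc_point by (fastforce simp: light_cone_def)
  have "half_turn ` light_cone = light_cone"
  proof
    \<comment> \<open>Every point is the image of its own half-turn, which lies on the cone by
      \<open>sub\<close>.\<close>
    show "light_cone \<subseteq> half_turn ` light_cone"
      using sub half_turn_half_turn by (metis image_eqI subsetI)
  qed (use sub in blast)
  ultimately show ?thesis by (simp add: lc_isometry_def)
qed

lemma soliton_half_turn:
  assumes "soliton r"
  shows "soliton (half_turn \<circ> r)"
proof -
  obtain \<Phi> where \<Phi>: "\<And>t. lc_isometry (\<Phi> t)" "\<Phi> 0 = id" "flow_solution (\<lambda>t s. \<Phi> t (r s))"
    and r: "lc_curve r"
    using assms unfolding soliton_def by blast
  \<comment> \<open>The motion is conjugated by the half-turn: it still starts at the identity, and
    applied to the turned curve its inner half-turn cancels.\<close>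
  let ?\<Psi> = "\<lambda>t. half_turn \<circ> (\<Phi> t \<circ> half_turn)"
  have "flow_solution (\<lambda>t s. ?\<Psi> t ((half_turn \<circ> r) s))"
    using flow_solution_isometry[OF lc_isometry_half_turn \<Phi>(3)] by (simp add: o_def)
  moreover have "\<forall>t. lc_isometry (?\<Psi> t)"
    using \<Phi>(1) lc_isometry_half_turn lc_isometry_comp by blast
  moreover have "?\<Psi> 0 = id" by (simp add: \<Phi>(2) fun_eq_iff)
  ultimately show ?thesis
    unfolding soliton_def using lc_curve_isometry[OF lc_isometry_half_turn r]
    by (intro conjI exI[of _ ?\<Psi>])
qed

text \<open>The curvature function is unchanged, hence so are its periodicity and the constants
  \<open>lam\<close> and \<mu>.\<close>

lemma space_periodic_soliton_half_turn:
  assumes "space_periodic_soliton r lam \<mu>"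
  shows "space_periodic_soliton (half_turn \<circ> r) lam \<mu>"
proof -
  have "lc_curve r" using assms by (simp add: space_periodic_soliton_def soliton_def)
  then have "geod_curv (half_turn \<circ> r) = geod_curv r"
    by (rule geod_curv_isometry[OF lc_isometry_half_turn])
  with assms soliton_half_turn[of r] show ?thesis
    by (simp add: space_periodic_soliton_def integration_constants_def)
qed

lemma lc_coordinates_half_turn:
  assumes "lc_coordinates r \<psi> \<theta>"
  shows "lc_coordinates (half_turn \<circ> r) \<psi> (\<lambda>s. \<theta> s + pi)"
  using assms unfolding lc_coordinates_def
  by (auto simp: half_turn_lc_point intro!: derivative_eq_intros)

text \<open>The flow field is carried along by the half-turn, whereas \<open>killing_z\<close>
  anticommutes with it; this reverses the sign of the constant.\<close>

lemma rotates_around_z_half_turn: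
  assumes "lc_curve r" "rotates_around_z r c"
  shows "rotates_around_z (half_turn \<circ> r) (- c)"
  using assms flow_field_isometry[OF lc_isometry_half_turn assms(1)]
  by (simp add: rotates_around_z_def vec_eq_iff forall_3)

subsection \<open>Rotating solitons in coordinates\<close>

context
  fixes r :: "real \<Rightarrow> real^3" and \<psi> \<theta> :: "real \<Rightarrow> real"
  assumes r: "lc_curve r" and coords: "lc_coordinates r \<psi> \<theta>"
begin

lemma psi_pos: "\<psi> s > 0" and r_eq: "r s = lc_point (\<psi> s) (\<theta> s)"
  and theta_deriv: "(\<theta> has_real_derivative 1 / \<psi> s) (at s)"
  using coords by (auto simp: lc_coordinates_def)

text \<open>\<psi> is the first coordinate of the smooth curve. Its first and second derivatives are
  therefore written as first coordinates of curve derivatives from here on.\<close>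

lemma psi_deriv: "(\<psi> has_real_derivative curve_deriv r s $ 1) (at s)"
  using has_vector_derivative_nth[OF lc_curve_deriv(1)[OF r, of s], of 1] by (simp add: r_eq)

lemma psi_deriv2:
  "((\<lambda>s. curve_deriv r s $ 1) has_real_derivative curve_deriv (curve_deriv r) s $ 1) (at s)"
  by (rule has_vector_derivative_nth[OF lc_curve_deriv(2)[OF r]])

lemma curve_deriv_coords:
  "curve_deriv r s $ 2 = curve_deriv r s $ 1 * cos (\<theta> s) - sin (\<theta> s)"
  "curve_deriv r s $ 3 = curve_deriv r s $ 1 * sin (\<theta> s) + cos (\<theta> s)"
proof -
  note D = has_vector_derivative_nth[OF lc_curve_deriv(1)[OF r, of s]]
  have "((\<lambda>s. \<psi> s * cos (\<theta> s)) has_real_derivative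
      curve_deriv r s $ 1 * cos (\<theta> s) - sin (\<theta> s)) (at s)"
    using psi_pos[of s]
    by (auto intro!: derivative_eq_intros psi_deriv theta_deriv simp: field_simps)
  then show "curve_deriv r s $ 2 = curve_deriv r s $ 1 * cos (\<theta> s) - sin (\<theta> s)"
    using D[of 2] by (simp add: r_eq DERIV_unique)
  have "((\<lambda>s. \<psi> s * sin (\<theta> s)) has_real_derivative
      curve_deriv r s $ 1 * sin (\<theta> s) + cos (\<theta> s)) (at s)"
    using psi_pos[of s]
    by (auto intro!: derivative_eq_intros psi_deriv theta_deriv simp: field_simps)
  then show "curve_deriv r s $ 3 = curve_deriv r s $ 1 * sin (\<theta> s) + cos (\<theta> s)"
    using D[of 3] by (simp add: r_eq DERIV_unique)
qed

lemma curve_deriv2_coords: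
  "curve_deriv (curve_deriv r) s $ 2 = curve_deriv (curve_deriv r) s $ 1 * cos (\<theta> s)
     - curve_deriv r s $ 1 * sin (\<theta> s) / \<psi> s - cos (\<theta> s) / \<psi> s"
  "curve_deriv (curve_deriv r) s $ 3 = curve_deriv (curve_deriv r) s $ 1 * sin (\<theta> s)
     + curve_deriv r s $ 1 * cos (\<theta> s) / \<psi> s - sin (\<theta> s) / \<psi> s"
proof -
  note D = has_vector_derivative_nth[OF lc_curve_deriv(2)[OF r, of s]]
  have "((\<lambda>s. curve_deriv r s $ 1 * cos (\<theta> s) - sin (\<theta> s)) has_real_derivative
      curve_deriv (curve_deriv r) s $ 1 * cos (\<theta> s)
       - curve_deriv r s $ 1 * sin (\<theta> s) / \<psi> s - cos (\<theta> s) / \<psi> s) (at s)"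
    by (auto intro!: derivative_eq_intros psi_deriv2 theta_deriv)
  with D[of 2] show "curve_deriv (curve_deriv r) s $ 2 = curve_deriv (curve_deriv r) s $ 1 * cos (\<theta> s)
     - curve_deriv r s $ 1 * sin (\<theta> s) / \<psi> s - cos (\<theta> s) / \<psi> s"
    by (simp add: curve_deriv_coords DERIV_unique)
  have "((\<lambda>s. curve_deriv r s $ 1 * sin (\<theta> s) + cos (\<theta> s)) has_real_derivative
      curve_deriv (curve_deriv r) s $ 1 * sin (\<theta> s)
       + curve_deriv r s $ 1 * cos (\<theta> s) / \<psi> s - sin (\<theta> s) / \<psi> s) (at s)"
    by (auto intro!: derivative_eq_intros psi_deriv2 theta_deriv)
  with D[of 3] show "curve_deriv (curve_deriv r) s $ 3 = curve_deriv (curve_deriv r) s $ 1 * sin (\<theta> s)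
     + curve_deriv r s $ 1 * cos (\<theta> s) / \<psi> s - sin (\<theta> s) / \<psi> s"
    by (simp add: curve_deriv_coords DERIV_unique)
qed

text \<open>The second derivative is paired with the explicit light-like normal. Denominators are
  cleared so that later use is purely polynomial.\<close>

lemma geod_curv_coords:
  "2 * (\<psi> s)\<^sup>2 * geod_curv r s
     = 2 * \<psi> s * curve_deriv (curve_deriv r) s $ 1 - (curve_deriv r s $ 1)\<^sup>2 - 1"
proof -
  \<comment> \<open>The reciprocal \<open>i\<close> of \<psi> is kept as a separate variable, so
    that the computation is polynomial modulo C^2 + S^2 = 1 and i p = 1.\<close>
  define p C S T1 A1 i where defs: "p = \<psi> s" "C = cos (\<theta> s)" "S = sin (\<theta> s)"
    "T1 = curve_deriv r s $ 1" "A1 = curve_deriv (curve_deriv r) s $ 1" "i = 1 / \<psi> s"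
  have CS: "C\<^sup>2 + S\<^sup>2 = 1" by (simp add: defs)
  have ip: "i * p = 1" using psi_pos[of s] by (simp add: defs)
  have "geod_curv r s = - (A1 * (- i / 2 - T1 * i * T1 + (T1 * i)\<^sup>2 / 2 * p))
    + (A1 * C - T1 * S * i - C * i) * (C * i / 2 - T1 * i * (T1 * C - S) + (T1 * i)\<^sup>2 / 2 * (p * C))
    + (A1 * S + T1 * C * i - S * i) * (S * i / 2 - T1 * i * (T1 * S + C) + (T1 * i)\<^sup>2 / 2 * (p * S))"
    unfolding geod_curv_def lightlike_normal_lc_point[OF r psi_pos r_eq, of s] lorentz_def
    by (simp add: curve_deriv2_coords curve_deriv_coords r_eq defs mult.commute[of "\<psi> s" 2])
  \<comment> \<open>This and the next two rewrites expose a factor \<open>i * p\<close>, which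
    \<open>ip\<close> then replaces by 1.\<close>
  also have "(T1 * i)\<^sup>2 / 2 * p = T1\<^sup>2 * i * (i * p) / 2"
    by (simp add: power2_eq_square)
  also have "(T1 * i)\<^sup>2 / 2 * (p * C) = T1\<^sup>2 * i * (i * p) * C / 2"
    by (simp add: power2_eq_square)
  also have "(T1 * i)\<^sup>2 / 2 * (p * S) = T1\<^sup>2 * i * (i * p) * S / 2"
    by (simp add: power2_eq_square)
  also have "- (A1 * (- i / 2 - T1 * i * T1 + T1\<^sup>2 * i * (i * p) / 2))
    + (A1 * C - T1 * S * i - C * i) * (C * i / 2 - T1 * i * (T1 * C - S) + T1\<^sup>2 * i * (i * p) * C / 2)
    + (A1 * S + T1 * C * i - S * i) * (S * i / 2 - T1 * i * (T1 * S + C) + T1\<^sup>2 * i * (i * p) * S / 2)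
    = A1 * i * (1 + T1\<^sup>2) / 2
      + (C\<^sup>2 + S\<^sup>2) * (A1 * i * (1 - T1\<^sup>2) / 2 - i\<^sup>2 * (1 - T1\<^sup>2) / 2 - T1\<^sup>2 * i\<^sup>2)"
    unfolding ip by (simp add: field_simps power2_eq_square)
  finally have k: "geod_curv r s = A1 * i - T1\<^sup>2 * i\<^sup>2 / 2 - i\<^sup>2 / 2"
    unfolding CS by (simp add: field_simps)
  have "2 * p\<^sup>2 * geod_curv r s = 2 * p * (i * p) * A1 - T1\<^sup>2 * (i * p)\<^sup>2 - (i * p)\<^sup>2"
    unfolding k by (simp add: field_simps power2_eq_square)
  then have "2 * p\<^sup>2 * geod_curv r s = 2 * p * A1 - T1\<^sup>2 - 1"
    unfolding ip by simp
  then show ?thesis by (simp add: defs)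
qed

lemma geod_curv_rotation:
  assumes "rotates_around_z r c"
  shows "geod_curv r s = c * (\<psi> s * sin (\<theta> s))"
proof -
  define C S T1 where defs: "C = cos (\<theta> s)" "S = sin (\<theta> s)" "T1 = curve_deriv r s $ 1"
  have CS: "C\<^sup>2 + S\<^sup>2 = 1" by (simp add: defs)
  have J: "flow_field r s = c *\<^sub>R killing_z (r s)" using assms by (simp add: rotates_around_z_def)
  have "deriv (geod_curv r) s * (\<psi> s * C) - geod_curv r s * (T1 * C - S) = c * \<psi> s"
    using J by (simp add: flow_field_def vec_eq_iff forall_3 r_eq curve_deriv_coords defs)
  moreover have "deriv (geod_curv r) s * (\<psi> s * S) - geod_curv r s * (T1 * S + C) = 0"
    using J by (simp add: flow_field_def vec_eq_iff forall_3 r_eq curve_deriv_coords defs)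
  \<comment> \<open>S times the first equation minus C times the second eliminates both k' and
    \<psi>', leaving k (C^2 + S^2) on the left.\<close>
  ultimately have "geod_curv r s = c * (\<psi> s * S)" using CS by algebra
  then show ?thesis by (simp add: defs)
qed

lemma rotation_constant:
  assumes rot: "rotates_around_z r c" and int: "integration_constants r lam \<mu>"
  shows "\<mu> = - c\<^sup>2"
proof -
  \<comment> \<open>Since \<mu> and \<open>c\<close> are constants, it suffices to compare them at
    the single point s = 0.\<close>
  define k k1 k2 where "k = geod_curv r 0" and "k1 = deriv (geod_curv r) 0"
    and "k2 = deriv (deriv (geod_curv r)) 0"
  define p C S T1 A1 i where defs: "p = \<psi> 0" "C = cos (\<theta> 0)" "S = sin (\<theta> 0)"
    "T1 = curve_deriv r 0 $ 1" "A1 = curve_deriv (curve_deriv r) 0 $ 1" "i = 1 / \<psi> 0"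
  have CS: "C\<^sup>2 + S\<^sup>2 = 1" by (simp add: defs)
  have ip: "i * p = 1" using psi_pos[of 0] by (simp add: defs)
  have g: "geod_curv r = (\<lambda>s. c * (\<psi> s * sin (\<theta> s)))"
    using geod_curv_rotation[OF rot] by (simp add: fun_eq_iff)
  have "(geod_curv r has_real_derivative c * (curve_deriv r s $ 1 * sin (\<theta> s) + cos (\<theta> s))) (at s)"
    for s
    unfolding g using psi_pos[of s]
    by (auto intro!: derivative_eq_intros psi_deriv theta_deriv simp: field_simps)
  then have g1: "deriv (geod_curv r) = (\<lambda>s. c * (curve_deriv r s $ 1 * sin (\<theta> s) + cos (\<theta> s)))"
    by (auto simp: fun_eq_iff intro: DERIV_imp_deriv)
  have "(deriv (geod_curv r) has_real_derivative c * (A1 * S + T1 * C * i - S * i)) (at 0)"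
    unfolding g1 by (auto intro!: derivative_eq_intros psi_deriv2 theta_deriv simp: defs)
  then have k2: "k2 = c * (A1 * S + T1 * C * i - S * i)"
    by (simp add: k2_def DERIV_imp_deriv)
  have k1: "k1 = c * (T1 * S + C)" by (simp add: k1_def g1 defs)
  have k: "k = c * (p * S)" by (simp add: k_def g defs)
  have kp: "2 * p\<^sup>2 * k = 2 * p * A1 - T1\<^sup>2 - 1"
    using geod_curv_coords[of 0] by (simp add: k_def defs)
  \<comment> \<open>Only k^2 is expressed through \<open>c\<close>, \<open>p\<close> and
    \<open>S\<close>; the remaining factor \<open>k\<close> is kept so that \<open>kp\<close> can
    trade it for \<psi>'' and \<psi>'.\<close>
  have "2 * k^3 = k\<^sup>2 * (2 * k)" by (simp add: power2_eq_square power3_eq_cube)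
  also have "\<dots> = c\<^sup>2 * S\<^sup>2 * (2 * p\<^sup>2 * k)"
    by (subst k) (simp add: power2_eq_square)
  finally have k3: "2 * k^3 = c\<^sup>2 * S\<^sup>2 * (2 * p * A1 - T1\<^sup>2 - 1)" unfolding kp .
  have "2 * k * k2 = c\<^sup>2 * (2 * p * A1 * S\<^sup>2 + 2 * S * (T1 * C - S) * (i * p))"
    by (simp add: k k2 algebra_simps power2_eq_square)
  then have kk2: "2 * k * k2 = c\<^sup>2 * (2 * p * A1 * S\<^sup>2 + 2 * S * (T1 * C - S))"
    by (simp add: ip)
  have C: "C\<^sup>2 = 1 - S\<^sup>2" using CS by simp
  have "k1\<^sup>2 = c\<^sup>2 * (T1\<^sup>2 * S\<^sup>2 + 2 * T1 * S * C + C\<^sup>2)"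
    by (simp add: k1 algebra_simps power2_eq_square)
  then have "2 * k * k2 - k1\<^sup>2 = 2 * k^3 - c\<^sup>2"
    unfolding k3 kk2 C by (simp add: algebra_simps power2_eq_square)
  moreover have "k2 - 3 / 2 * k\<^sup>2 + lam / 2 = 0" "k1\<^sup>2 - k^3 + lam * k + \<mu> = 0"
    using int by (simp_all add: integration_constants_def k_def k1_def k2_def)
  \<comment> \<open>The soliton equations give 2 k k'' - k'^2 = 2 k^3 + \<mu>, in which
    \<open>lam\<close> cancels; comparison with 2 k^3 - c^2 yields the claim.\<close>
  ultimately show ?thesis by algebra
qed

end

text \<open>Aligning the axis with the z-axis leaves its direction open, which is the sign of
  \<open>c\<close>. For c < 0 the formula holds directly; for c > 0 it holds for the turned curve,
  which is again such a soliton, with constant -c.\<close>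

theorem proposition4p17:
  fixes r :: "real \<Rightarrow> real^3" and \<psi> \<theta> :: "real \<Rightarrow> real" and lam \<mu> c :: real
  assumes "space_periodic_soliton r lam \<mu>"
    and "lc_coordinates r \<psi> \<theta>"
    and "rotates_around_z r c"
  shows "\<mu> < 0 \<and>
    (c < 0 \<longrightarrow> (\<forall>s. \<psi> s * sin (\<theta> s) = - geod_curv r s / sqrt (- \<mu>))) \<and>
    (c > 0 \<longrightarrow>
       space_periodic_soliton (half_turn \<circ> r) lam \<mu> \<and>
       lc_coordinates (half_turn \<circ> r) \<psi> (\<lambda>s. \<theta> s + pi) \<and>
       rotates_around_z (half_turn \<circ> r) (- c) \<and>
       (\<forall>s. \<psi> s * sin (\<theta> s + pi) = - geod_curv (half_turn \<circ> r) s / sqrt (- \<mu>)))"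
proof -
  have r: "lc_curve r" and int: "integration_constants r lam \<mu>"
    using assms(1) by (auto simp: space_periodic_soliton_def soliton_def)
  have c: "c \<noteq> 0" using assms(3) by (simp add: rotates_around_z_def)
  have \<mu>: "\<mu> = - c\<^sup>2" by (rule rotation_constant[OF r assms(2,3) int])
  \<comment> \<open>As \<psi> sin \<theta> = k / c, the minus sign of the formula is right when |c|
    = -c; otherwise it comes from sin (\<theta> + \<pi>) = - sin \<theta>.\<close>
  then have sq: "sqrt (- \<mu>) = \<bar>c\<bar>" by simp
  note k = geod_curv_rotation[OF r assms(2,3)]
  show ?thesis
  proof (intro conjI impI allI)
    show "\<mu> < 0" using c \<mu> by simp
    show "\<psi> s * sin (\<theta> s) = - geod_curv r s / sqrt (- \<mu>)" if "c < 0" for s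
      using that by (simp add: sq k)
    show "\<psi> s * sin (\<theta> s + pi) = - geod_curv (half_turn \<circ> r) s / sqrt (- \<mu>)" if "c > 0" for s
      using that by (simp add: sq k geod_curv_isometry[OF lc_isometry_half_turn r])
  qed (use assms r in \<open>simp_all add: space_periodic_soliton_half_turn lc_coordinates_half_turn
        rotates_around_z_half_turn\<close>)
qed

end
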